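(* Let $\alpha,\beta\ge 0$, and let $\varphi(z)=1+B_1z+B_2z^2+\cdots$ and $\psi(z)=1+D_1z+D_2z^2+\cdots$ be analytic functions on $\mathbb{D}$ with $B_1>0$, $D_1>0$ and $B_2,D_2\in\mathbb{R}$. Let $f(z)=z+\sum_{n=2}^{\infty}a_nz^n$ be bi-univalent in $\mathbb{D}$ and let $g=f^{-1}$. If $f\in\mathcal{P}(\alpha,\varphi)$ and $g\in\mathcal{P}(\beta,\psi)$, then, with $\sigma:=2+7\alpha+7\beta+24\alpha\beta$, $$|a_2|\le \frac{B_1D_1\sqrt{B_1(1+3\beta)+D_1(1+3\alpha)}}{\sqrt{\left|\sigma B_1^2D_1^2-(1+2\alpha)^2(1+3\beta)(B_2-B_1)D_1^2-(1+2\beta)^2(1+3\alpha)(D_2-D_1)B_1^2\right|}}$$ (provided the denominator is nonzero), and $$2\sigma|a_3|\le B_1(3+10\beta)+D_1(1+2\alpha)+(3+10\beta)|B_2-B_1|+\frac{(1+2\beta)^2B_1^2|D_2-D_1|}{D_1^2(1+2\alpha)}.$$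
   Context: $\mathbb{D}=\{z\in\mathbb{C}:|z|<1\}$. $\mathcal{S}$ is the class of univalent (injective) analytic functions $f$ on $\mathbb{D}$ with $f(0)=0$, $f'(0)=1$. By the Koebe one-quarter theorem each $f\in\mathcal{S}$ has an inverse $f^{-1}$ defined at least on $|w|<1/4$. A function $f\in\mathcal{S}$ is bi-univalent in $\mathbb{D}$ if both $f$ and $f^{-1}$ are univalent in $\mathbb{D}$, i.e. the local inverse $f^{-1}$ at $0$ extends to a univalent analytic function on $\mathbb{D}$, still denoted $f^{-1}$. Subordination: for analytic $F,G$ on $\mathbb{D}$, $F(z)\prec G(z)$ means there is an analytic $w:\mathbb{D}\to\mathbb{D}$ with $w(0)=0$ and $F(z)=G(w(z))$ on $\mathbb{D}$. For $\alpha\ge0$ and analytic $\varphi:\mathbb{D}\to\mathbb{C}$, $\varphi(z)=1+B_1z+B_2z^2+\cdots$ with $B_1>0$, $B_2\in\mathbb{R}$, $$\mathcal{P}(\alpha,\varphi):=\left\{f\in\mathcal{S}:\ \frac{zf'(z)}{f(z)}+\alpha\frac{z^2f''(z)}{f(z)}\prec\varphi(z)\right\}$$ (quotients are given their limiting values at $z=0$). No univalence or positivity of the real part of $\varphi,\psi$ is assumed. *)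

theory Defs
  imports "HOL-Complex_Analysis.Complex_Analysis"
begin

abbreviation unit_disc :: "complex set" ("\<D>")
  where "\<D> \<equiv> ball 0 1"

definition class_S :: "(complex \<Rightarrow> complex) set"
  where "class_S = {f. f holomorphic_on \<D> \<and> inj_on f \<D> \<and> f 0 = 0 \<and> deriv f 0 = 1}"

text \<open>
  The inverse of \<open>f\<close> at \<open>0\<close> is only a germ: \<open>inv_into \<D> f w\<close> is meaningful
  for \<open>w \<in> f ` \<D>\<close>, and \<open>f ` \<D>\<close> is a neighbourhood of \<open>0\<close> but need not contain
  \<open>\<D>\<close>. The values on \<open>\<D>\<close> of a function \<open>g\<close> related to \<open>f\<close> below are determined
  uniquely by the identity theorem; its values outside \<open>\<D>\<close> are irrelevant.
\<close>

definition univalent_inverse :: "(complex \<Rightarrow> complex) \<Rightarrow> (complex \<Rightarrow> complex) \<Rightarrow> bool"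
  where "univalent_inverse f g \<longleftrightarrow>
    g holomorphic_on \<D> \<and> inj_on g \<D> \<and> (\<forall>\<^sub>F w in nhds 0. g w = inv_into \<D> f w)"

definition bi_univalent :: "(complex \<Rightarrow> complex) \<Rightarrow> bool"
  where "bi_univalent f \<longleftrightarrow> f \<in> class_S \<and> (\<exists>g. univalent_inverse f g)"

text \<open>Analyticity of \<open>F\<close> on \<open>\<D>\<close> follows from that of \<open>G\<close>, which is assumed where this is used.\<close>

definition subordinate :: "(complex \<Rightarrow> complex) \<Rightarrow> (complex \<Rightarrow> complex) \<Rightarrow> bool" (infix "\<prec>" 50)
  where "F \<prec> G \<longleftrightarrow>
    (\<exists>w. w holomorphic_on \<D> \<and> w ` \<D> \<subseteq> \<D> \<and> w 0 = 0 \<and> (\<forall>z\<in>\<D>. F z = G (w z)))"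

text \<open>\<open>remove_sings\<close> gives the quotients, which read \<open>0 / 0\<close> at the origin, their limiting values there.\<close>

definition class_P :: "real \<Rightarrow> (complex \<Rightarrow> complex) \<Rightarrow> (complex \<Rightarrow> complex) set"
  where "class_P \<alpha> \<phi> = {f \<in> class_S.
    (\<lambda>z. remove_sings (\<lambda>z. z * deriv f z / f z) z
       + of_real \<alpha> * remove_sings (\<lambda>z. z\<^sup>2 * deriv (deriv f) z / f z) z) \<prec> \<phi>}"

end

theory Submission
  imports Defs
begin

text \<open>
  Comparing coefficients in \<open>f \<cdot> (\<phi> \<circ> w) = z f' + \<alpha> z\<^sup>2 f''\<close>, and likewise for \<open>g\<close>, whose
  coefficients are \<open>- a\<^sub>2\<close> and \<open>2 a\<^sub>2\<^sup>2 - a\<^sub>3\<close>, expresses \<open>a\<^sub>2\<close> and \<open>a\<^sub>3\<close> through the first two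
  coefficients \<open>c\<close> and \<open>q - c\<^sup>2\<close> of each Schwarz function. Eliminating \<open>a\<^sub>3\<close>, respectively
  \<open>a\<^sub>2\<^sup>2\<close>, from the two second-order equations leaves linear combinations to which
  \<open>\<bar>c\<bar> \<le> 1\<close> and \<open>\<bar>q\<bar> \<le> 1\<close> apply. The bound on \<open>q\<close> is the Caratheodory bound
  \<open>\<bar>p\<^sub>2\<bar> \<le> 2\<close> for the function \<open>(1 + w) / (1 - w)\<close>.
\<close>

section \<open>Power series at the origin and coefficient bounds for Schwarz functions\<close>

lemma eventually_in_unit_disc: "\<forall>\<^sub>F z in nhds 0. z \<in> \<D>"
  by (intro eventually_nhds_in_open) auto

lemma fps_eq_if_eventually_eq:
  fixes F G :: "complex fps"
  assumes "\<forall>\<^sub>F z in nhds 0. f z = g z" "f has_fps_expansion F" "g has_fps_expansion G"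
  shows "F = G"
  using has_fps_expansion_cong[OF assms(1) refl, of F] assms(2,3) fps_expansion_unique_complex
  by blast

text \<open>Writing \<open>w z = z * h z\<close> shifts the coefficients: those of orders 1 and 2 of
  \<open>w\<close> are \<open>h 0\<close> and \<open>deriv h 0\<close>. The Schwarz-Pick inequality
  at the origin, |h'(0)| \<le> 1 - |h(0)|^2, and the triangle inequality then give the second bound.
  The combination W_2 + W_1^2 is half the second coefficient of (1 + w) / (1 - w).\<close>

lemma schwarz_coeff_bounds:
  assumes hol: "w holomorphic_on \<D>" and sub: "w ` \<D> \<subseteq> \<D>" and w0: "w 0 = 0"
    and W: "w has_fps_expansion W"
  shows "cmod (fps_nth W 1) \<le> 1" and "cmod (fps_nth W 2 + (fps_nth W 1)\<^sup>2) \<le> 1"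
proof -
  have no: "cmod (w z) < 1" if "cmod z < 1" for z
    using sub that by (force simp: image_subset_iff)
  obtain h where h: "h holomorphic_on \<D>" "\<And>z. cmod z < 1 \<Longrightarrow> w z = z * h z" "deriv w 0 = h 0"
    using Schwarz3[OF hol w0] by blast
  define H where "H = fps_expansion h 0"
  have H: "h has_fps_expansion H"
    unfolding H_def by (rule has_fps_expansion_fps_expansion[of \<D>]) (use h in auto)
  have H0: "fps_nth H 0 = h 0"
    using H by (simp add: H_def fps_expansion_def)
  have "\<forall>\<^sub>F z in nhds 0. w z = z * h z"
    using eventually_in_unit_disc by eventually_elim (simp add: h)
  moreover note W
  moreover have "(\<lambda>z. z * h z) has_fps_expansion fps_X * H"
    by (intro fps_expansion_intros H)
  ultimately have WH: "W = fps_X * H"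
    by (rule fps_eq_if_eventually_eq)
  have W12: "fps_nth W 1 = h 0" "fps_nth W 2 = fps_nth H 1"
    by (simp_all add: WH H0 numeral_2_eq_2)
  have h0: "cmod (h 0) \<le> 1"
    using Schwarz_Lemma(2)[OF hol w0 no, of 0] h(3) by simp
  then show "cmod (fps_nth W 1) \<le> 1" by (simp only: W12)
  have "cmod (fps_nth H 1) \<le> 1 - (cmod (h 0))\<^sup>2"
  proof (cases "\<forall>z. cmod z < 1 \<longrightarrow> cmod (h z) < 1")
    case True
    \<comment> \<open>If \<open>h\<close> maps the disc into itself, following it by the disc
      automorphism that sends \<open>h 0\<close> to 0 yields a function to which Schwarz's lemma
      applies at the origin.\<close>
    define m where "m z = Moebius_function 0 (h 0) (h z)" for z
    have lt: "cmod (h 0) < 1" using True by simp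
    have mhol: "m holomorphic_on \<D>"
      using holomorphic_on_compose_gen[OF h(1) Moebius_function_holomorphic[OF lt, of 0]] True
      by (simp add: m_def[abs_def] o_def image_subset_iff)
    have m0: "m 0 = 0" by (simp add: m_def Moebius_function_eq_zero)
    have mno: "cmod (m z) < 1" if "cmod z < 1" for z
      using Moebius_function_norm_lt_1[OF lt] True that by (simp add: m_def)
    have dm: "cmod (deriv m 0) \<le> 1"
      using Schwarz_Lemma(2)[OF mhol m0 mno, of 0] by simp
    have dh: "(h has_field_derivative deriv h 0) (at 0)"
      using h(1) by (intro holomorphic_derivI[of h \<D>]) auto
    have n2: "cnj (h 0) * h 0 = of_real ((cmod (h 0))\<^sup>2)"
      by (simp add: complex_norm_square mult.commute del: of_real_power)
    have lt2: "(cmod (h 0))\<^sup>2 < 1"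
      using lt by (simp add: abs_square_less_1)
    have nz: "1 - cnj (h 0) * h 0 \<noteq> 0"
      using lt2 unfolding n2 by (metis less_irrefl of_real_1 of_real_eq_iff right_minus_eq)
    \<comment> \<open>The numerator of the Moebius quotient vanishes at 0, so the quotient rule
      leaves only the derivative of the numerator over the denominator.\<close>
    have "(m has_field_derivative deriv h 0 / (1 - cnj (h 0) * h 0)) (at 0)"
      unfolding m_def[abs_def] Moebius_function_simple
      by (rule derivative_eq_intros dh nz refl | use nz in \<open>simp add: divide_simps\<close>)+
    then have "deriv m 0 = deriv h 0 / (1 - of_real ((cmod (h 0))\<^sup>2))"
      unfolding n2 by (rule DERIV_imp_deriv)
    also have "1 - of_real ((cmod (h 0))\<^sup>2) = complex_of_real (1 - (cmod (h 0))\<^sup>2)" by simp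
    finally have "cmod (deriv h 0) / (1 - (cmod (h 0))\<^sup>2) \<le> 1"
      using dm lt2 by (simp only: norm_divide norm_of_real abs_of_pos diff_gt_0_iff_gt)
    then have "cmod (deriv h 0) \<le> 1 - (cmod (h 0))\<^sup>2"
      using lt2 by (simp add: divide_simps)
    then show ?thesis by (simp add: H_def fps_expansion_def)
  next
    case False
    then obtain z where z: "cmod z < 1" "\<not> cmod (h z) < 1" by blast
    have "cmod (w z) \<le> cmod z"
      using Schwarz_Lemma(1)[OF hol w0 no z(1)] .
    \<comment> \<open>A point with |h(z)| \<ge> 1 is an equality case of Schwarz's lemma: in the
      values of \<open>w\<close> if z is not 0, in the derivative at 0 otherwise. Hence
      \<open>w\<close> is a rotation, and both sides of the Schwarz-Pick inequality are 0.\<close>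
    then have "(z \<noteq> 0 \<and> cmod (w z) = cmod z) \<or> cmod (deriv w 0) = 1"
      using z h h0 by (cases "z = 0") (auto simp: norm_mult)
    then obtain c where c: "\<forall>z. cmod z < 1 \<longrightarrow> w z = c * z" "cmod c = 1"
      using Schwarz_Lemma(3)[OF hol w0 no z(1)] z(1) by blast
    have "\<forall>\<^sub>F z in nhds 0. w z = c * z"
      using eventually_in_unit_disc by eventually_elim (use c in simp)
    moreover note W
    moreover have "(\<lambda>z. c * z) has_fps_expansion fps_const c * fps_X"
      by (intro fps_expansion_intros)
    ultimately have "W = fps_const c * fps_X"
      by (rule fps_eq_if_eventually_eq)
    then have "fps_nth W 1 = c" "fps_nth W 2 = 0" by simp_all
    then show ?thesis using W12 c(2) by simp
  qed
  then show "cmod (fps_nth W 2 + (fps_nth W 1)\<^sup>2) \<le> 1"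
    using norm_triangle_ineq[of "fps_nth H 1" "(h 0)\<^sup>2"] unfolding W12 norm_power by linarith
qed

section \<open>Coefficient relations from the subordination\<close>

text \<open>Here c = W_1 and q = W_2 + W_1^2 for the Schwarz function \<open>w\<close> of the
  subordination. Replacing W_2 by q - c^2 is what turns the coefficient of c^2 into the difference
  of the first two coefficients of \<phi>.\<close>

lemma class_P_coeffs:
  assumes f: "f \<in> class_P \<alpha> \<phi>" and F: "f has_fps_expansion F"
    and \<Phi>: "\<phi> has_fps_expansion \<Phi>" and \<Phi>0: "fps_nth \<Phi> 0 = 1"
  obtains c q where "cmod c \<le> 1" and "cmod q \<le> 1"
    and "of_real (1 + 2 * \<alpha>) * fps_nth F 2 = fps_nth \<Phi> 1 * c"
    and "of_real (2 + 6 * \<alpha>) * fps_nth F 3 - of_real (1 + 2 * \<alpha>) * (fps_nth F 2)\<^sup>2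
           = fps_nth \<Phi> 1 * q + (fps_nth \<Phi> 2 - fps_nth \<Phi> 1) * c\<^sup>2"
proof -
  have fS: "f holomorphic_on \<D>" "inj_on f \<D>" "f 0 = 0" "deriv f 0 = 1"
    using f by (auto simp: class_P_def class_S_def)
  obtain w where w: "w holomorphic_on \<D>" "w ` \<D> \<subseteq> \<D>" "w 0 = 0"
    and eq: "\<And>z. z \<in> \<D> \<Longrightarrow> remove_sings (\<lambda>z. z * deriv f z / f z) z
       + of_real \<alpha> * remove_sings (\<lambda>z. z\<^sup>2 * deriv (deriv f) z / f z) z = \<phi> (w z)"
    using f by (auto simp: class_P_def subordinate_def)
  have F0: "fps_nth F 0 = 0"
    using has_fps_expansion_imp_0_eq_fps_nth_0[OF F] fS by simp
  have F1: "fps_nth F 1 = 1"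
    using has_fps_expansion_imp_0_eq_fps_nth_0[OF has_fps_expansion_deriv[OF F]] fS by simp
  \<comment> \<open>Away from 0, injectivity makes \<open>f z\<close> nonzero, so the quotients are
    analytic there, \<open>remove_sings\<close> returns their own values, and the denominator can be
    cleared. At 0 both sides vanish.\<close>
  have rel: "f z * \<phi> (w z) = z * deriv f z + of_real \<alpha> * (z\<^sup>2 * deriv (deriv f) z)"
    if z: "z \<in> \<D>" for z
  proof (cases "z = 0")
    case False
    then have nz: "f z \<noteq> 0"
      using inj_onD[OF fS(2), of z 0] z fS(3) by auto
    have an: "f analytic_on {z}"
      using fS(1) z by (meson analytic_at open_ball)
    have "remove_sings (\<lambda>z. z * deriv f z / f z) z = z * deriv f z / f z"
      by (rule remove_sings_at_analytic) (use an nz in \<open>auto intro!: analytic_intros\<close>)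
    moreover have "remove_sings (\<lambda>z. z\<^sup>2 * deriv (deriv f) z / f z) z
        = z\<^sup>2 * deriv (deriv f) z / f z"
      by (rule remove_sings_at_analytic) (use an nz in \<open>auto intro!: analytic_intros\<close>)
    ultimately show ?thesis
      using eq[OF z, symmetric] nz by (simp add: field_simps)
  qed (simp add: fS)
  define W where "W = fps_expansion w 0"
  have W: "w has_fps_expansion W"
    unfolding W_def by (rule has_fps_expansion_fps_expansion[of \<D>]) (use w in auto)
  have W0: "fps_nth W 0 = 0"
    using has_fps_expansion_imp_0_eq_fps_nth_0[OF W] w by simp
  have "\<forall>\<^sub>F z in nhds 0. f z * (\<phi> \<circ> w) z
      = z * deriv f z + of_real \<alpha> * (z ^ 2 * deriv (deriv f) z)"
    using eventually_in_unit_disc by eventually_elim (simp add: rel)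
  moreover have "(\<lambda>z. f z * (\<phi> \<circ> w) z) has_fps_expansion F * (\<Phi> oo W)"
    by (intro fps_expansion_intros F \<Phi> W W0)
  moreover have "(\<lambda>z. z * deriv f z + of_real \<alpha> * (z ^ 2 * deriv (deriv f) z)) has_fps_expansion
      fps_X * fps_deriv F + fps_const (of_real \<alpha>) * (fps_X ^ 2 * fps_deriv (fps_deriv F))"
    by (intro fps_expansion_intros F)
  ultimately have E: "F * (\<Phi> oo W)
      = fps_X * fps_deriv F + fps_const (of_real \<alpha>) * (fps_X ^ 2 * fps_deriv (fps_deriv F))"
    by (rule fps_eq_if_eventually_eq)
  have P1: "fps_nth (\<Phi> oo W) 1 = fps_nth \<Phi> 1 * fps_nth W 1"
    by (simp add: fps_compose_nth W0)
  have P2: "fps_nth (\<Phi> oo W) 2 = fps_nth \<Phi> 1 * fps_nth W 2 + fps_nth \<Phi> 2 * (fps_nth W 1)\<^sup>2"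
    by (simp add: fps_compose_nth W0 numeral_2_eq_2 fps_mult_nth)
  \<comment> \<open>Since \<open>f\<close> starts with z, order 1 only reads 1 = 1. Orders 2 and 3
    carry the first and second coefficients of \<open>w\<close>.\<close>
  have "fps_nth (F * (\<Phi> oo W)) 2 = fps_nth F 2 + fps_nth \<Phi> 1 * fps_nth W 1"
    using P1 F0 F1 \<Phi>0 by (simp add: fps_mult_nth numeral_2_eq_2)
  moreover have "fps_nth (fps_X * fps_deriv F
      + fps_const (of_real \<alpha>) * (fps_X ^ 2 * fps_deriv (fps_deriv F))) 2
      = 2 * fps_nth F 2 + 2 * of_real \<alpha> * fps_nth F 2"
    by (simp add: fps_X_power_mult_nth flip: numeral_2_eq_2 numeral_3_eq_3)
  ultimately have e1: "of_real (1 + 2 * \<alpha>) * fps_nth F 2 = fps_nth \<Phi> 1 * fps_nth W 1"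
    unfolding E by (simp add: algebra_simps)
  have "fps_nth (F * (\<Phi> oo W)) 3 = fps_nth F 3 + fps_nth F 2 * (fps_nth \<Phi> 1 * fps_nth W 1)
      + (fps_nth \<Phi> 1 * fps_nth W 2 + fps_nth \<Phi> 2 * (fps_nth W 1)\<^sup>2)"
    using P1 P2 F0 F1 \<Phi>0 by (simp add: fps_mult_nth numeral_3_eq_3 numeral_2_eq_2)
  moreover have "fps_nth (fps_X * fps_deriv F
      + fps_const (of_real \<alpha>) * (fps_X ^ 2 * fps_deriv (fps_deriv F))) 3
      = 3 * fps_nth F 3 + 6 * of_real \<alpha> * fps_nth F 3"
    by (simp add: fps_X_power_mult_nth flip: numeral_2_eq_2 numeral_3_eq_3)
  \<comment> \<open>The factor (1 + 2\<alpha>) a_2 stays unexpanded so that \<open>e1\<close> can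
    turn it into the product occurring in the Cauchy product.\<close>
  ultimately have e2: "of_real (2 + 6 * \<alpha>) * fps_nth F 3
      = fps_nth F 2 * (of_real (1 + 2 * \<alpha>) * fps_nth F 2)
      + (fps_nth \<Phi> 1 * fps_nth W 2 + fps_nth \<Phi> 2 * (fps_nth W 1)\<^sup>2)"
    unfolding E e1 by (simp add: algebra_simps)
  show ?thesis
    by (rule that[OF schwarz_coeff_bounds[OF w W] e1])
      (simp only: e2, simp add: algebra_simps power2_eq_square)
qed

section \<open>The power series of the inverse\<close>

lemma inverse_fps_coeffs:
  fixes F G :: "complex fps"
  assumes "G oo F = fps_X" and F0: "fps_nth F 0 = 0" and F1: "fps_nth F 1 = 1"
  shows "fps_nth G 2 = - fps_nth F 2" and "fps_nth G 3 = 2 * (fps_nth F 2)\<^sup>2 - fps_nth F 3"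
proof -
  have "fps_nth (G oo F) 1 = 1" "fps_nth (G oo F) 2 = 0" "fps_nth (G oo F) 3 = 0"
    by (simp_all add: assms(1))
  then have *: "fps_nth G 1 = 1" "fps_nth G 1 * fps_nth F 2 + fps_nth G 2 = 0"
      "fps_nth G 1 * fps_nth F 3 + fps_nth G 2 * (2 * fps_nth F 2) + fps_nth G 3 = 0"
    using F0 F1
    by (simp_all add: fps_compose_nth fps_mult_nth numeral_2_eq_2 numeral_3_eq_3 algebra_simps)
  then show "fps_nth G 2 = - fps_nth F 2"
    by (metis add.inverse_unique mult_1)
  with * show "fps_nth G 3 = 2 * (fps_nth F 2)\<^sup>2 - fps_nth F 3"
    by (simp add: power2_eq_square algebra_simps eq_neg_iff_add_eq_0)
qed

text \<open>The function \<open>g\<close> is tied to \<open>f\<close> only by a germ at 0. As f(z)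
  tends to 0, that germ identity may be evaluated at f(z), where injectivity of \<open>f\<close> on
  the disc reduces \<open>inv_into\<close> to z.\<close>

lemma univalent_inverse_fps_compose:
  assumes f: "f \<in> class_S" and g: "univalent_inverse f g"
    and F: "f has_fps_expansion F" and G: "g has_fps_expansion G"
  shows "G oo F = fps_X"
proof -
  have f0: "f 0 = 0" and inj: "inj_on f \<D>" and hol: "f holomorphic_on \<D>"
    using f by (auto simp: class_S_def)
  have F0: "fps_nth F 0 = 0"
    using has_fps_expansion_imp_0_eq_fps_nth_0[OF F] f0 by simp
  have "filterlim f (nhds 0) (nhds 0)"
    using hol f0 continuous_on_eq_continuous_at[of \<D> f]
    by (metis centre_in_ball continuous_at holomorphic_on_imp_continuous_on isCont_def
        open_ball tendsto_at_iff_tendsto_nhds zero_less_one)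
  then have "\<forall>\<^sub>F z in nhds 0. g (f z) = inv_into \<D> f (f z)"
    using g by (auto simp: univalent_inverse_def intro: eventually_compose_filterlim)
  then have "\<forall>\<^sub>F z in nhds 0. (g \<circ> f) z = z"
    using eventually_in_unit_disc by eventually_elim (use inj in simp)
  moreover have "(g \<circ> f) has_fps_expansion (G oo F)"
    by (intro fps_expansion_intros F G F0)
  ultimately show ?thesis
    using has_fps_expansion_fps_X by (rule fps_eq_if_eventually_eq)
qed

text \<open>The theorem gives its series as tails, with finitely many leading terms subtracted, and
  leaves the leading entries of the coefficient sequences arbitrary. Here the first k entries are
  overwritten by the subtracted coefficients.\<close>

lemma has_fps_expansion_of_sums:
  fixes f :: "complex \<Rightarrow> complex"
  assumes "\<And>z. z \<in> \<D> \<Longrightarrow> (\<lambda>n. c (n + k) * z ^ (n + k)) sums (f z - (\<Sum>n<k. b n * z ^ n))"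
  shows "f has_fps_expansion Abs_fps (\<lambda>n. if n < k then b n else c n)"
proof (rule has_fps_expansionI)
  show "\<forall>\<^sub>F z in nhds 0. (\<lambda>n. fps_nth (Abs_fps (\<lambda>n. if n < k then b n else c n)) n * z ^ n)
      sums f z"
    using eventually_in_unit_disc
  proof eventually_elim
    case (elim z)
    have "(\<Sum>n<k. (if n < k then b n else c n) * z ^ n) = (\<Sum>n<k. b n * z ^ n)"
      by (intro sum.cong) auto
    then show ?case
      using assms[OF elim] by (subst sums_iff_shift'[of _ k, symmetric]) simp
  qed
qed

section \<open>Elimination and estimates\<close>

lemma coeff_bounds:
  fixes \<alpha> \<beta> B1 B2 D1 D2 :: real and a2 a3 c q d r :: complex
  defines "\<sigma> \<equiv> 2 + 7 * \<alpha> + 7 * \<beta> + 24 * \<alpha> * \<beta>"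
  defines "\<Delta> \<equiv> \<sigma> * B1\<^sup>2 * D1\<^sup>2 - (1 + 2 * \<alpha>)\<^sup>2 * (1 + 3 * \<beta>) * (B2 - B1) * D1\<^sup>2
                - (1 + 2 * \<beta>)\<^sup>2 * (1 + 3 * \<alpha>) * (D2 - D1) * B1\<^sup>2"
  assumes \<alpha>: "\<alpha> \<ge> 0" and \<beta>: "\<beta> \<ge> 0" and B1: "B1 > 0" and D1: "D1 > 0"
    and le: "cmod c \<le> 1" "cmod q \<le> 1" "cmod r \<le> 1"
    and e1: "of_real (1 + 2 * \<alpha>) * a2 = of_real B1 * c"
    and e2: "of_real (2 + 6 * \<alpha>) * a3 - of_real (1 + 2 * \<alpha>) * a2\<^sup>2
               = of_real B1 * q + (of_real B2 - of_real B1) * c\<^sup>2"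
    and e3: "of_real (1 + 2 * \<beta>) * (- a2) = of_real D1 * d"
    and e4: "of_real (2 + 6 * \<beta>) * (2 * a2\<^sup>2 - a3) - of_real (1 + 2 * \<beta>) * (- a2)\<^sup>2
               = of_real D1 * r + (of_real D2 - of_real D1) * d\<^sup>2"
  shows "\<bar>\<Delta>\<bar> * (cmod a2)\<^sup>2 \<le> B1\<^sup>2 * D1\<^sup>2 * (B1 * (1 + 3 * \<beta>) + D1 * (1 + 3 * \<alpha>))"
    and "2 * \<sigma> * cmod a3 \<le>
          B1 * (3 + 10 * \<beta>) + D1 * (1 + 2 * \<alpha>) + (3 + 10 * \<beta>) * \<bar>B2 - B1\<bar>
            + (1 + 2 * \<beta>)\<^sup>2 * B1\<^sup>2 * \<bar>D2 - D1\<bar> / (D1\<^sup>2 * (1 + 2 * \<alpha>))"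
proof -
  let ?c = complex_of_real
  have s1: "(1 + 2 * ?c \<alpha>)\<^sup>2 * a2\<^sup>2 = (?c B1)\<^sup>2 * c\<^sup>2"
    using arg_cong[OF e1, of "\<lambda>x. x\<^sup>2"] by (simp add: power_mult_distrib)
  have s3: "(1 + 2 * ?c \<beta>)\<^sup>2 * a2\<^sup>2 = (?c D1)\<^sup>2 * d\<^sup>2"
    using arg_cong[OF e3, of "\<lambda>x. x\<^sup>2"] by (simp add: power_mult_distrib)
  have E2: "(2 + 6 * ?c \<alpha>) * a3 - (1 + 2 * ?c \<alpha>) * a2\<^sup>2 = ?c B1 * q + (?c B2 - ?c B1) * c\<^sup>2"
    using e2 by simp
  have E4: "(2 + 6 * ?c \<beta>) * (2 * a2\<^sup>2 - a3) - (1 + 2 * ?c \<beta>) * a2\<^sup>2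
      = ?c D1 * r + (?c D2 - ?c D1) * d\<^sup>2"
    using e4 by simp
  \<comment> \<open>The weights 1 + 3\<beta> and 1 + 3\<alpha> cancel a_3, because 2 + 6\<alpha> and
    2 + 6\<beta> are twice 1 + 3\<alpha> and 1 + 3\<beta>. What remains of a_2^2 has coefficient
    \<sigma>.\<close>
  have "?c \<sigma> * a2\<^sup>2 = (1 + 3 * ?c \<beta>) * (?c B1 * q + (?c B2 - ?c B1) * c\<^sup>2)
      + (1 + 3 * ?c \<alpha>) * (?c D1 * r + (?c D2 - ?c D1) * d\<^sup>2)"
    unfolding E2[symmetric] E4[symmetric] \<sigma>_def by (simp add: algebra_simps)
  \<comment> \<open>After multiplication by B1^2 D1^2, \<open>s1\<close> and \<open>s3\<close>
    express c^2 and d^2 through a_2^2. Moving these terms to the left turns \<sigma> B1^2 D1^2 into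
    \<Delta>, and only q and r remain on the right.\<close>
  then have "?c \<Delta> * a2\<^sup>2
      = (?c B1)\<^sup>2 * (?c D1)\<^sup>2 * (?c (B1 * (1 + 3 * \<beta>)) * q + ?c (D1 * (1 + 3 * \<alpha>)) * r)"
    unfolding \<Delta>_def using s1 s3 by simp algebra
  then have "cmod (?c \<Delta> * a2\<^sup>2)
      = B1\<^sup>2 * D1\<^sup>2 * cmod (?c (B1 * (1 + 3 * \<beta>)) * q + ?c (D1 * (1 + 3 * \<alpha>)) * r)"
    by (simp only: norm_mult norm_power norm_of_real power2_abs)
  also have "\<dots> \<le> B1\<^sup>2 * D1\<^sup>2 * (B1 * (1 + 3 * \<beta>) * 1 + D1 * (1 + 3 * \<alpha>) * 1)"
    using \<alpha> \<beta> B1 D1 le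
    by (intro mult_left_mono norm_triangle_le add_mono)
      (simp_all only: norm_mult norm_of_real, auto intro!: mult_left_le)
  finally show "\<bar>\<Delta>\<bar> * (cmod a2)\<^sup>2 \<le> B1\<^sup>2 * D1\<^sup>2 * (B1 * (1 + 3 * \<beta>) + D1 * (1 + 3 * \<alpha>))"
    by (simp add: norm_mult norm_power)
  \<comment> \<open>Both \<open>s1\<close> and \<open>s3\<close> determine a_2^2, so d^2 is a fixed
    multiple of c^2. The constant \<open>K\<close> is that multiple times 1 + 2\<alpha>, the weight
    that the second equation receives below. It produces the last term of the bound.\<close>
  define K where "K = (1 + 2 * \<beta>)\<^sup>2 * B1\<^sup>2 / (D1\<^sup>2 * (1 + 2 * \<alpha>))"
  have nz: "D1\<^sup>2 * (1 + 2 * \<alpha>) \<noteq> 0" using D1 \<alpha> by simp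
  have K: "K * (D1\<^sup>2 * (1 + 2 * \<alpha>)) = (1 + 2 * \<beta>)\<^sup>2 * B1\<^sup>2"
    unfolding K_def using nz by simp
  have Kc: "?c K * ((?c D1)\<^sup>2 * (1 + 2 * ?c \<alpha>)) = (1 + 2 * ?c \<beta>)\<^sup>2 * (?c B1)\<^sup>2"
    using arg_cong[OF K, of ?c] by simp
  have nzc: "(?c D1)\<^sup>2 * (1 + 2 * ?c \<alpha>) \<noteq> 0"
    using nz[folded of_real_eq_0_iff[where 'a = complex]] by simp
  have "(?c D1)\<^sup>2 * (1 + 2 * ?c \<alpha>) * ((1 + 2 * ?c \<alpha>) * d\<^sup>2)
      = (?c D1)\<^sup>2 * (1 + 2 * ?c \<alpha>) * (?c K * c\<^sup>2)"
    using s1 s3 Kc by algebra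
  then have d2: "(1 + 2 * ?c \<alpha>) * d\<^sup>2 = ?c K * c\<^sup>2"
    using nzc mult_left_cancel by blast
  \<comment> \<open>In the second equation a_2^2 has coefficient 2(2 + 6\<beta>) - (1 + 2\<beta>) =
    3 + 10\<beta>, in the first -(1 + 2\<alpha>). Cross-weighting cancels a_2^2 and leaves 2\<sigma>
    in front of a_3.\<close>
  have "?c (2 * \<sigma>) * a3 = (3 + 10 * ?c \<beta>) * (?c B1 * q + (?c B2 - ?c B1) * c\<^sup>2)
      + (1 + 2 * ?c \<alpha>) * (?c D1 * r + (?c D2 - ?c D1) * d\<^sup>2)"
    unfolding E2[symmetric] E4[symmetric] \<sigma>_def by (simp add: algebra_simps)
  also have "\<dots> = ?c (B1 * (3 + 10 * \<beta>)) * q + ?c (D1 * (1 + 2 * \<alpha>)) * r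
      + ?c ((3 + 10 * \<beta>) * (B2 - B1)) * c\<^sup>2 + ?c (K * (D2 - D1)) * c\<^sup>2"
    using d2 by simp algebra
  finally have "cmod (?c (2 * \<sigma>) * a3) \<le> cmod (?c (B1 * (3 + 10 * \<beta>)) * q)
      + cmod (?c (D1 * (1 + 2 * \<alpha>)) * r)
      + cmod (?c ((3 + 10 * \<beta>) * (B2 - B1)) * c\<^sup>2) + cmod (?c (K * (D2 - D1)) * c\<^sup>2)"
    by (simp only:) (intro norm_triangle_le add_mono order_refl)
  also have "\<dots> \<le> \<bar>B1 * (3 + 10 * \<beta>)\<bar> + \<bar>D1 * (1 + 2 * \<alpha>)\<bar>
      + \<bar>(3 + 10 * \<beta>) * (B2 - B1)\<bar> + \<bar>K * (D2 - D1)\<bar>"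
    unfolding norm_mult norm_of_real
    by (intro add_mono mult_left_le) (use le in \<open>auto simp: norm_power power_le_one\<close>)
  also have "\<dots> = B1 * (3 + 10 * \<beta>) + D1 * (1 + 2 * \<alpha>) + (3 + 10 * \<beta>) * \<bar>B2 - B1\<bar>
      + K * \<bar>D2 - D1\<bar>"
    using \<alpha> \<beta> B1 D1 by (simp add: abs_mult K_def)
  finally have "cmod (?c (2 * \<sigma>) * a3) \<le> B1 * (3 + 10 * \<beta>) + D1 * (1 + 2 * \<alpha>)
      + (3 + 10 * \<beta>) * \<bar>B2 - B1\<bar> + K * \<bar>D2 - D1\<bar>" .
  moreover have "\<sigma> \<ge> 0" using \<alpha> \<beta> by (simp add: \<sigma>_def)
  ultimately show "2 * \<sigma> * cmod a3 \<le>
          B1 * (3 + 10 * \<beta>) + D1 * (1 + 2 * \<alpha>) + (3 + 10 * \<beta>) * \<bar>B2 - B1\<bar>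
            + (1 + 2 * \<beta>)\<^sup>2 * B1\<^sup>2 * \<bar>D2 - D1\<bar> / (D1\<^sup>2 * (1 + 2 * \<alpha>))"
    by (simp add: norm_mult K_def)
qed

section \<open>Assembling the two bounds\<close>

lemma le_divide_sqrt_abs:
  fixes x b t N :: real
  assumes "\<bar>t\<bar> * x\<^sup>2 \<le> b\<^sup>2 * N" and "b \<ge> 0" and "sqrt \<bar>t\<bar> \<noteq> 0"
  shows "x \<le> b * sqrt N / sqrt \<bar>t\<bar>"
proof -
  have "sqrt \<bar>t\<bar> * \<bar>x\<bar> \<le> b * sqrt N"
    using real_sqrt_le_mono[OF assms(1)] \<open>b \<ge> 0\<close> by (simp add: real_sqrt_mult)
  moreover have "sqrt \<bar>t\<bar> > 0" using assms(3) by simp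
  ultimately have "\<bar>x\<bar> \<le> b * sqrt N / sqrt \<bar>t\<bar>"
    by (simp add: pos_le_divide_eq mult.commute)
  then show ?thesis by linarith
qed

theorem theorem2p1:
  fixes \<alpha> \<beta> \<sigma> B1 B2 D1 D2 :: real
    and \<phi> \<psi> f g :: "complex \<Rightarrow> complex"
    and a B D :: "nat \<Rightarrow> complex"
  assumes "\<alpha> \<ge> 0" and "\<beta> \<ge> 0"
    and "\<phi> holomorphic_on \<D>" and "\<psi> holomorphic_on \<D>"
    and "\<And>z. z \<in> \<D> \<Longrightarrow> (\<lambda>n. B (n + 1) * z ^ (n + 1)) sums (\<phi> z - 1)"
    and "\<And>z. z \<in> \<D> \<Longrightarrow> (\<lambda>n. D (n + 1) * z ^ (n + 1)) sums (\<psi> z - 1)"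
    and "B 1 = of_real B1" and "B 2 = of_real B2" and "B1 > 0"
    and "D 1 = of_real D1" and "D 2 = of_real D2" and "D1 > 0"
    and "bi_univalent f" and "univalent_inverse f g"
    and "\<And>z. z \<in> \<D> \<Longrightarrow> (\<lambda>n. a (n + 2) * z ^ (n + 2)) sums (f z - z)"
    and "f \<in> class_P \<alpha> \<phi>" and "g \<in> class_P \<beta> \<psi>"
    and "\<sigma> = 2 + 7 * \<alpha> + 7 * \<beta> + 24 * \<alpha> * \<beta>"
  shows "(sqrt \<bar>\<sigma> * B1\<^sup>2 * D1\<^sup>2
              - (1 + 2 * \<alpha>)\<^sup>2 * (1 + 3 * \<beta>) * (B2 - B1) * D1\<^sup>2
              - (1 + 2 * \<beta>)\<^sup>2 * (1 + 3 * \<alpha>) * (D2 - D1) * B1\<^sup>2\<bar> \<noteq> 0 \<longrightarrow>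
          cmod (a 2) \<le> B1 * D1 * sqrt (B1 * (1 + 3 * \<beta>) + D1 * (1 + 3 * \<alpha>))
            / sqrt \<bar>\<sigma> * B1\<^sup>2 * D1\<^sup>2
              - (1 + 2 * \<alpha>)\<^sup>2 * (1 + 3 * \<beta>) * (B2 - B1) * D1\<^sup>2
              - (1 + 2 * \<beta>)\<^sup>2 * (1 + 3 * \<alpha>) * (D2 - D1) * B1\<^sup>2\<bar>)
    \<and> 2 * \<sigma> * cmod (a 3) \<le>
          B1 * (3 + 10 * \<beta>) + D1 * (1 + 2 * \<alpha>) + (3 + 10 * \<beta>) * \<bar>B2 - B1\<bar>
            + (1 + 2 * \<beta>)\<^sup>2 * B1\<^sup>2 * \<bar>D2 - D1\<bar> / (D1\<^sup>2 * (1 + 2 * \<alpha>))"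
proof -
  define \<Phi> where "\<Phi> = Abs_fps (\<lambda>n. if n < 1 then 1 else B n)"
  define \<Psi> where "\<Psi> = Abs_fps (\<lambda>n. if n < 1 then 1 else D n)"
  \<comment> \<open>For n < 2, \<open>of_nat n\<close> gives 0 and 1, the coefficients of the
    subtracted term z.\<close>
  define F where "F = Abs_fps (\<lambda>n. if n < 2 then of_nat n else a n)"
  define G where "G = fps_expansion g 0"
  have \<Phi>: "\<phi> has_fps_expansion \<Phi>"
    unfolding \<Phi>_def by (rule has_fps_expansion_of_sums) (use assms(5) in simp)
  have \<Psi>: "\<psi> has_fps_expansion \<Psi>"
    unfolding \<Psi>_def by (rule has_fps_expansion_of_sums) (use assms(6) in simp)
  have F: "f has_fps_expansion F"
    unfolding F_def by (rule has_fps_expansion_of_sums)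
      (use assms(15) in \<open>simp add: lessThan_nat_numeral\<close>)
  have G: "g has_fps_expansion G"
    unfolding G_def by (rule has_fps_expansion_fps_expansion[of \<D>])
      (use assms(14) in \<open>auto simp: univalent_inverse_def\<close>)
  have "G oo F = fps_X"
    using assms(13) by (intro univalent_inverse_fps_compose[OF _ assms(14) F G])
      (simp add: bi_univalent_def)
  note G23 = inverse_fps_coeffs[OF this]
  have nth [simp]: "fps_nth \<Phi> 0 = 1" "fps_nth \<Phi> 1 = of_real B1" "fps_nth \<Phi> 2 = of_real B2"
    "fps_nth \<Psi> 0 = 1" "fps_nth \<Psi> 1 = of_real D1" "fps_nth \<Psi> 2 = of_real D2"
    "fps_nth F 0 = 0" "fps_nth F 1 = 1" "fps_nth F 2 = a 2" "fps_nth F 3 = a 3"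
    using assms(7,8,10,11) by (simp_all add: \<Phi>_def \<Psi>_def F_def)
  have G2: "fps_nth G 2 = - a 2" and G3: "fps_nth G 3 = 2 * (a 2)\<^sup>2 - a 3"
    using G23 nth by simp_all
  obtain c q where cq: "cmod c \<le> 1" "cmod q \<le> 1"
    "of_real (1 + 2 * \<alpha>) * a 2 = of_real B1 * c"
    "of_real (2 + 6 * \<alpha>) * a 3 - of_real (1 + 2 * \<alpha>) * (a 2)\<^sup>2
       = of_real B1 * q + (of_real B2 - of_real B1) * c\<^sup>2"
    by (rule class_P_coeffs[OF assms(16) F \<Phi> nth(1), unfolded nth])
  \<comment> \<open>The same relations for \<open>g\<close>, with its coefficients already rewritten
    through those of \<open>f\<close>.\<close>
  obtain d r where dr: "cmod d \<le> 1" "cmod r \<le> 1"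
    "of_real (1 + 2 * \<beta>) * (- a 2) = of_real D1 * d"
    "of_real (2 + 6 * \<beta>) * (2 * (a 2)\<^sup>2 - a 3) - of_real (1 + 2 * \<beta>) * (- a 2)\<^sup>2
       = of_real D1 * r + (of_real D2 - of_real D1) * d\<^sup>2"
    by (rule class_P_coeffs[OF assms(17) G \<Psi> nth(4), unfolded nth G2 G3])
  have bounds:
    "\<bar>\<sigma> * B1\<^sup>2 * D1\<^sup>2 - (1 + 2 * \<alpha>)\<^sup>2 * (1 + 3 * \<beta>) * (B2 - B1) * D1\<^sup>2
        - (1 + 2 * \<beta>)\<^sup>2 * (1 + 3 * \<alpha>) * (D2 - D1) * B1\<^sup>2\<bar> * (cmod (a 2))\<^sup>2
      \<le> B1\<^sup>2 * D1\<^sup>2 * (B1 * (1 + 3 * \<beta>) + D1 * (1 + 3 * \<alpha>))"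
      (is "\<bar>?\<Delta>\<bar> * _ \<le> ?N")
    "2 * \<sigma> * cmod (a 3) \<le>
          B1 * (3 + 10 * \<beta>) + D1 * (1 + 2 * \<alpha>) + (3 + 10 * \<beta>) * \<bar>B2 - B1\<bar>
            + (1 + 2 * \<beta>)\<^sup>2 * B1\<^sup>2 * \<bar>D2 - D1\<bar> / (D1\<^sup>2 * (1 + 2 * \<alpha>))"
    unfolding assms(18)
    by (fact coeff_bounds[OF assms(1,2,9,12) cq(1,2) dr(2) cq(3,4) dr(3,4)])+
  have "?N = (B1 * D1)\<^sup>2 * (B1 * (1 + 3 * \<beta>) + D1 * (1 + 3 * \<alpha>))"
    by (simp only: power_mult_distrib)
  with bounds(1) have "sqrt \<bar>?\<Delta>\<bar> \<noteq> 0 \<longrightarrow>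
      cmod (a 2) \<le> B1 * D1 * sqrt (B1 * (1 + 3 * \<beta>) + D1 * (1 + 3 * \<alpha>)) / sqrt \<bar>?\<Delta>\<bar>"
    using assms(9,12) by (intro impI le_divide_sqrt_abs) auto
  with bounds(2) show ?thesis by blast
qed

end
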